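(* Let $E=\prod_{i=1}^\infty\mathbb{C}$ be equipped with the product $\sigma$-algebra $\bigotimes_{i=1}^{\infty}\mathcal{B}$, where $\mathcal{B}$ is the Borel $\sigma$-algebra of $\mathbb{C}$. Let $\sigma:E\to\mathbb{C}$ be a closed-valued open-measurable multifunction, and define its tail part $\sigma_\sim:E\to\mathbb{C}$ by $$\sigma_\sim(x)=\bigcap_{n\ge 1}\ \bigcap_{\vec y\in\mathbb{C}^{n-1}}\sigma(\vec y,x_n,x_{n+1},\ldots).$$ Then the multifunction $\sigma_\sim$ is universally open-measurable.
   Context: A multifunction $F:E\to\mathbb{C}$ is a function assigning to each $x\in E$ a (possibly empty) subset $F(x)\subset\mathbb{C}$; it is closed-valued if every $F(x)$ is closed. Put $F^{-1}(U)=\{x\in E : F(x)\cap U\neq\emptyset\}$. $F$ is open-measurable if $F^{-1}(U)$ is measurable for every open $U\subset\mathbb{C}$, and universally open-measurable if $F^{-1}(U)$ is universally measurable for every open $U\subset\mathbb{C}$. Universally measurable sets: for a finite positive measure $\nu$ on a measurable space $(E,\mathcal{E})$, $\mathcal{E}_\nu$ is the family of sets $B\subset E$ for which there are $A,C\in\mathcal{E}$ with $A\subset B\subset C$ and $\nu(C\setminus A)=0$. A set is universally measurable if it belongs to $\bigcap_\nu \mathcal{E}_\nu$, the intersection being over all finite positive measures $\nu$ on $\mathcal{E}$. For $n=1$ the tuple $\vec y\in\mathbb{C}^0$ is empty, so the corresponding set is $\sigma(x)$ itself. *)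

theory Defs
  imports "HOL-Analysis.Analysis"
begin

definition multi_preimage :: "'a measure \<Rightarrow> ('a \<Rightarrow> complex set) \<Rightarrow> complex set \<Rightarrow> 'a set" where
  "multi_preimage M F U = {x \<in> space M. F x \<inter> U \<noteq> {}}"

definition closed_valued :: "'a measure \<Rightarrow> ('a \<Rightarrow> complex set) \<Rightarrow> bool" where
  "closed_valued M F \<longleftrightarrow> (\<forall>x \<in> space M. closed (F x))"

definition completed_sets :: "'a measure \<Rightarrow> 'a set set" where
  "completed_sets \<nu> =
    {B. \<exists>A \<in> sets \<nu>. \<exists>C \<in> sets \<nu>. A \<subseteq> B \<and> B \<subseteq> C \<and> emeasure \<nu> (C - A) = 0}"

lemma completed_sets_eq_sets_completion: "completed_sets \<nu> = sets (completion \<nu>)"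
proof (intro subset_antisym subsetI)
  fix B assume "B \<in> completed_sets \<nu>"
  then obtain A C where AC: "A \<in> sets \<nu>" "C \<in> sets \<nu>" "A \<subseteq> B" "B \<subseteq> C" "emeasure \<nu> (C - A) = 0"
    unfolding completed_sets_def by blast
  show "B \<in> sets (completion \<nu>)"
  proof (rule sets_completionI)
    show "B = A \<union> (B - A)" using AC by blast
    show "B - A \<subseteq> C - A" using AC by blast
    show "C - A \<in> null_sets \<nu>" using AC by auto
  qed (fact AC)
next
  fix B assume "B \<in> sets (completion \<nu>)"
  then obtain S N N' where SN: "B = S \<union> N" "S \<in> sets \<nu>" "N' \<in> null_sets \<nu>" "N \<subseteq> N'"
    by (elim sets_completionE)
  have "emeasure \<nu> ((S \<union> N') - S) = 0"
    by (rule emeasure_eq_0[of N']) (use SN in auto)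
  moreover have "S \<union> N' \<in> sets \<nu>" "S \<subseteq> B" "B \<subseteq> S \<union> N'"
    using SN by auto
  ultimately show "B \<in> completed_sets \<nu>"
    unfolding completed_sets_def using SN(2) by blast
qed

text \<open>Only the measurable space underlying \<open>M\<close> matters here; its measure plays no role.\<close>

definition universally_measurable_sets :: "'a measure \<Rightarrow> 'a set set" where
  "universally_measurable_sets M =
    (\<Inter>\<nu> \<in> {\<nu>. finite_measure \<nu> \<and> sets \<nu> = sets M}. completed_sets \<nu>)"

definition open_measurable :: "'a measure \<Rightarrow> ('a \<Rightarrow> complex set) \<Rightarrow> bool" where
  "open_measurable M F \<longleftrightarrow> (\<forall>U. open U \<longrightarrow> multi_preimage M F U \<in> sets M)"

definition universally_open_measurable :: "'a measure \<Rightarrow> ('a \<Rightarrow> complex set) \<Rightarrow> bool" where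
  "universally_open_measurable M F \<longleftrightarrow>
    (\<forall>U. open U \<longrightarrow> multi_preimage M F U \<in> universally_measurable_sets M)"

text \<open>Sequences are indexed from 0: the coordinate \<open>x\<^sub>i\<close> of the product is \<open>x (i - 1)\<close>.
  Hence \<open>replace_prefix y x\<close> is \<open>(y, x\<^sub>n, x\<^sub>n\<^sub>+\<^sub>1, \<dots>)\<close> when \<open>y\<close> has length \<open>n - 1\<close>.\<close>

definition replace_prefix :: "complex list \<Rightarrow> (nat \<Rightarrow> complex) \<Rightarrow> nat \<Rightarrow> complex" where
  "replace_prefix y x = (\<lambda>i. if i < length y then y ! i else x i)"

definition tail_part :: "((nat \<Rightarrow> complex) \<Rightarrow> complex set) \<Rightarrow> (nat \<Rightarrow> complex) \<Rightarrow> complex set" where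
  "tail_part \<sigma> x = (\<Inter>n \<in> {1..}. \<Inter>y \<in> {y. length y = n - 1}. \<sigma> (replace_prefix y x))"

abbreviation complex_sequences :: "(nat \<Rightarrow> complex) measure" where
  "complex_sequences \<equiv> (\<Pi>\<^sub>M i \<in> UNIV. borel)"

end

theory Submission
  imports Defs
begin

text \<open>Since \<open>\<sigma>\<close> is closed-valued, compactness of \<open>K\<close> turns \<open>tail_part \<sigma> x \<inter> K = {}\<close> into the
  existence of a finite cover of \<open>K\<close> by basic open sets \<open>B\<close>, each of which misses \<open>\<sigma> (y, x\<^sub>n, \<dots>)\<close>
  for some \<open>n\<close> and some prefix \<open>y\<close>. For fixed \<open>n\<close> and \<open>B\<close> the latter condition is the projection
  of a Borel set of pairs of sequences, that is, an analytic set, and analytic sets are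
  universally measurable by Choquet's capacity argument.\<close>

section \<open>Projections of closed sets\<close>

text \<open>Analytic sets, with \<open>\<complex>\<^sup>\<nat>\<close> in place of the Baire space as the parameter space. It contains
  \<open>\<nat>\<^sup>\<nat>\<close> as a closed subset and is exhausted by compact boxes coordinate by coordinate.\<close>

definition souslin :: "'a::metric_space set \<Rightarrow> bool" where
  "souslin A \<longleftrightarrow> (\<exists>C :: ('a \<times> (nat \<Rightarrow> complex)) set. closed C \<and> A = fst ` C)"

lemma souslinI:
  fixes C :: "('a::metric_space \<times> (nat \<Rightarrow> complex)) set"
  assumes "closed C" "\<And>x. x \<in> A \<longleftrightarrow> (\<exists>w. (x, w) \<in> C)"
  shows "souslin A"
proof -
  have "A = fst ` C" using assms(2) by force
  then show ?thesis unfolding souslin_def using assms(1) by blast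
qed

lemma souslinE:
  fixes A :: "'a::metric_space set"
  assumes "souslin A"
  obtains C :: "('a \<times> (nat \<Rightarrow> complex)) set" where "closed C" "\<And>x. x \<in> A \<longleftrightarrow> (\<exists>w. (x, w) \<in> C)"
proof -
  obtain C :: "('a \<times> (nat \<Rightarrow> complex)) set" where "closed C" "A = fst ` C"
    using assms unfolding souslin_def by blast
  then show ?thesis using that[of C] by force
qed

lemma closed_souslin: "closed A \<Longrightarrow> souslin A"
  by (rule souslinI[of "A \<times> UNIV"]) (auto intro: closed_Times)

lemma continuous_on_coordinate_snd:
  "continuous_on UNIV (\<lambda>p :: 'a::topological_space \<times> (nat \<Rightarrow> complex). snd p i)"
  by (rule continuous_on_product_then_coordinatewise[OF continuous_on_snd[OF continuous_on_id]])

text \<open>An equation \<open>d * w 0 = 1\<close> is closed, yet solvable for \<open>w 0\<close>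
  exactly when the distance \<open>d\<close> to the complement is nonzero. \<open>A = UNIV\<close>
  is split off because \<open>infdist\<close> to the empty set is 0 by convention.\<close>

lemma open_souslin:
  fixes A :: "'a::metric_space set"
  assumes "open A"
  shows "souslin A"
proof (cases "A = UNIV")
  case True
  then show ?thesis by (simp add: closed_souslin)
next
  case False
  let ?C = "{p :: 'a \<times> (nat \<Rightarrow> complex). of_real (infdist (fst p) (- A)) * snd p 0 = 1}"
  show ?thesis
  proof (rule souslinI[of ?C])
    show "closed ?C"
      by (intro closed_Collect_eq continuous_intros continuous_on_coordinate_snd)
    fix x
    have "x \<in> A \<longleftrightarrow> infdist x (- A) \<noteq> 0"
      using in_closed_iff_infdist_zero[of "- A" x] assms False by auto
    also have "\<dots> \<longleftrightarrow> (\<exists>w. (x, w) \<in> ?C)"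
    proof
      assume "infdist x (- A) \<noteq> 0"
      then have "(x, \<lambda>_. 1 / of_real (infdist x (- A))) \<in> ?C" by simp
      then show "\<exists>w. (x, w) \<in> ?C" by blast
    qed auto
    finally show "x \<in> A \<longleftrightarrow> (\<exists>w. (x, w) \<in> ?C)" .
  qed
qed

lemma closed_reindex_snd:
  fixes C :: "('a::topological_space \<times> (nat \<Rightarrow> complex)) set" and h :: "nat \<Rightarrow> nat"
  assumes "closed C"
  shows "closed {p. (fst p, \<lambda>i. snd p (h i)) \<in> C}"
proof -
  have "continuous_on UNIV (\<lambda>p :: 'a \<times> (nat \<Rightarrow> complex). (fst p, \<lambda>i. snd p (h i)))"
    by (intro continuous_intros continuous_on_coordinate_snd)
  with assms have "closed ((\<lambda>p. (fst p, \<lambda>i. snd p (h i))) -` C)"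
    by (rule closed_vimage)
  then show ?thesis by (simp add: vimage_def)
qed

lemma souslin_UN:
  fixes A :: "nat \<Rightarrow> 'a::metric_space set"
  assumes "\<And>n. souslin (A n)"
  shows "souslin (\<Union>n. A n)"
proof -
  have "\<exists>C :: ('a \<times> (nat \<Rightarrow> complex)) set. closed C \<and> (\<forall>x. x \<in> A n \<longleftrightarrow> (\<exists>w. (x, w) \<in> C))" for n
    using assms by (metis souslinE)
  then obtain C :: "nat \<Rightarrow> ('a \<times> (nat \<Rightarrow> complex)) set"
    where C: "\<And>n. closed (C n)" "\<And>n x. x \<in> A n \<longleftrightarrow> (\<exists>w. (x, w) \<in> C n)"
    by metis
  text \<open>Coordinate \<open>0\<close> names the index of the set. Natural numbers being 1-separated, the
    implication \<open>w 0 = n \<longrightarrow> \<dots>\<close> may be weakened to a closed condition.\<close>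
  let ?D = "{p :: 'a \<times> (nat \<Rightarrow> complex). snd p 0 \<in> \<nat>} \<inter>
    (\<Inter>n. {p. 1 \<le> dist (snd p 0) (of_nat n)} \<union> {p. (fst p, \<lambda>i. snd p (Suc i)) \<in> C n})"
  show ?thesis
  proof (rule souslinI[of ?D])
    have "continuous_on UNIV (\<lambda>p :: 'a \<times> (nat \<Rightarrow> complex). snd p 0)"
      by (rule continuous_on_coordinate_snd)
    then have "closed ((\<lambda>p :: 'a \<times> (nat \<Rightarrow> complex). snd p 0) -` \<nat>)"
      by (intro closed_vimage closed_Nats)
    moreover have "closed {p :: 'a \<times> (nat \<Rightarrow> complex). 1 \<le> dist (snd p 0) (of_nat n)}" for n
      by (intro closed_Collect_le continuous_intros continuous_on_coordinate_snd)
    ultimately show "closed ?D"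
      by (intro closed_Int closed_INT ballI closed_Un closed_reindex_snd C) (simp_all add: vimage_def)
    fix x
    show "x \<in> (\<Union>n. A n) \<longleftrightarrow> (\<exists>w. (x, w) \<in> ?D)"
    proof
      assume "x \<in> (\<Union>n. A n)"
      then obtain n w where w: "(x, w) \<in> C n" using C by blast
      have "1 \<le> dist (of_nat n :: complex) (of_nat m) \<or> m = n" for m
        unfolding dist_of_nat by linarith
      then show "\<exists>w. (x, w) \<in> ?D"
        using w by (intro exI[of _ "case_nat (of_nat n) w"]) auto
    next
      assume "\<exists>w. (x, w) \<in> ?D"
      then obtain w where w: "(x, w) \<in> ?D" ..
      then obtain n where "w 0 = of_nat n" by (auto simp: Nats_def)
      with w have "(x, \<lambda>i. w (Suc i)) \<in> C n" by (auto dest: spec[of _ n])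
      then show "x \<in> (\<Union>n. A n)" using C by blast
    qed
  qed
qed

text \<open>One parameter sequence stores a witness for every \<open>n\<close> at once, the
  \<open>n\<close>-th in the coordinates \<open>prod_encode (n, i)\<close>; the conditions then form
  an intersection of closed sets.\<close>

lemma souslin_INT:
  fixes A :: "nat \<Rightarrow> 'a::metric_space set"
  assumes "\<And>n. souslin (A n)"
  shows "souslin (\<Inter>n. A n)"
proof -
  have "\<exists>C :: ('a \<times> (nat \<Rightarrow> complex)) set. closed C \<and> (\<forall>x. x \<in> A n \<longleftrightarrow> (\<exists>w. (x, w) \<in> C))" for n
    using assms by (metis souslinE)
  then obtain C :: "nat \<Rightarrow> ('a \<times> (nat \<Rightarrow> complex)) set"
    where C: "\<And>n. closed (C n)" "\<And>n x. x \<in> A n \<longleftrightarrow> (\<exists>w. (x, w) \<in> C n)"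
    by metis
  let ?D = "\<Inter>n. {p. (fst p, \<lambda>i. snd p (prod_encode (n, i))) \<in> C n}"
  show ?thesis
  proof (rule souslinI[of ?D])
    show "closed ?D"
      by (intro closed_INT ballI closed_reindex_snd C)
    fix x
    show "x \<in> (\<Inter>n. A n) \<longleftrightarrow> (\<exists>w. (x, w) \<in> ?D)"
    proof
      assume "x \<in> (\<Inter>n. A n)"
      then have "\<forall>n. \<exists>w. (x, w) \<in> C n" using C by blast
      then obtain w where "\<And>n. (x, w n) \<in> C n" by metis
      then show "\<exists>w. (x, w) \<in> ?D"
        by (intro exI[of _ "\<lambda>k. case prod_decode k of (n, i) \<Rightarrow> w n i"]) simp
    qed (use C in auto)
  qed
qed

text \<open>Complements of analytic sets need not be analytic, so the induction over the generated
  \<sigma>-algebra carries the claim for a set and its complement together.\<close>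

lemma borel_souslin:
  fixes A :: "'a::metric_space set"
  assumes "A \<in> sets borel"
  shows "souslin A"
proof -
  have "A \<in> sigma_sets UNIV {S. open S}"
    using assms by (simp add: borel_def)
  then have "souslin A \<and> souslin (- A)"
  proof induction
    case (Basic a)
    then show ?case by (auto intro: open_souslin closed_souslin)
  next
    case (Union a)
    then have "souslin (\<Union>n. a n)" "souslin (\<Inter>n. - a n)"
      by (auto intro: souslin_UN souslin_INT)
    then show ?case by (simp add: Compl_UN)
  qed (auto simp: closed_souslin simp flip: Compl_eq_Diff_UNIV)
  then show ?thesis ..
qed

text \<open>Two successive projections become one: the projected coordinate \<open>y\<close> and the
  parameter \<open>w\<close> are interleaved as the even and odd entries of one sequence.\<close>

lemma souslin_fst_image:
  fixes A :: "('a::metric_space \<times> (nat \<Rightarrow> complex)) set"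
  assumes "souslin A"
  shows "souslin (fst ` A)"
proof -
  obtain C :: "(('a \<times> (nat \<Rightarrow> complex)) \<times> (nat \<Rightarrow> complex)) set"
    where C: "closed C" "\<And>p. p \<in> A \<longleftrightarrow> (\<exists>w. (p, w) \<in> C)"
    using assms by (metis souslinE)
  let ?f = "\<lambda>p :: 'a \<times> (nat \<Rightarrow> complex). ((fst p, \<lambda>i. snd p (2 * i)), \<lambda>i. snd p (2 * i + 1))"
  show ?thesis
  proof (rule souslinI[of "?f -` C"])
    have "continuous_on UNIV ?f"
      by (intro continuous_intros continuous_on_coordinate_snd)
    then show "closed (?f -` C)"
      by (intro closed_vimage C)
    fix x
    show "x \<in> fst ` A \<longleftrightarrow> (\<exists>w. (x, w) \<in> ?f -` C)"
    proof
      assume "x \<in> fst ` A"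
      then obtain y w where "((x, y), w) \<in> C" using C by force
      then show "\<exists>w. (x, w) \<in> ?f -` C"
        by (intro exI[of _ "\<lambda>k. if even k then y (k div 2) else w (k div 2)"]) simp
    next
      assume "\<exists>w. (x, w) \<in> ?f -` C"
      then show "x \<in> fst ` A" using C(2) by (force simp: image_iff)
    qed
  qed
qed

section \<open>Capacitability\<close>

lemma le_if_le_add_inverse_Suc:
  fixes a b :: real
  assumes "\<And>k. a \<le> b + 1 / real (Suc k)"
  shows "a \<le> b"
proof (rule ccontr)
  assume "\<not> a \<le> b"
  then obtain k where "1 / real (Suc k) < a - b"
    using nat_approx_posE[of "a - b"] by auto
  then show False using assms[of k] by linarith
qed

text \<open>The outer measure induced by \<open>M\<close>. Being a real infimum, it is meaningful
  for finite \<open>M\<close> and \<open>S \<subseteq> space M\<close>.\<close>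

definition hull_measure :: "'a measure \<Rightarrow> 'a set \<Rightarrow> real" where
  "hull_measure M S = (INF B \<in> {B \<in> sets M. S \<subseteq> B}. measure M B)"

lemma (in finite_measure) hull_measure_le:
  assumes "B \<in> sets M" "S \<subseteq> B"
  shows "hull_measure M S \<le> measure M B"
  unfolding hull_measure_def using assms
  by (intro cINF_lower bdd_belowI[of _ 0]) auto

text \<open>A countable intersection of nearly optimal measurable supersets is optimal.\<close>

lemma (in finite_measure) hull_measure_attained:
  assumes "S \<subseteq> space M"
  obtains H where "H \<in> sets M" "S \<subseteq> H" "measure M H = hull_measure M S"
proof -
  have bdd: "bdd_below (measure M ` {B \<in> sets M. S \<subseteq> B})"
    by (rule bdd_belowI[of _ 0]) auto
  have ne: "{B \<in> sets M. S \<subseteq> B} \<noteq> {}" using assms by blast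
  have "\<exists>B. B \<in> sets M \<and> S \<subseteq> B \<and> measure M B < hull_measure M S + 1 / real (Suc j)" for j
  proof -
    have "hull_measure M S < hull_measure M S + 1 / real (Suc j)" by simp
    then show ?thesis unfolding hull_measure_def cINF_less_iff[OF ne bdd] by blast
  qed
  then obtain B where B: "\<And>j. B j \<in> sets M" "\<And>j. S \<subseteq> B j"
    "\<And>j. measure M (B j) < hull_measure M S + 1 / real (Suc j)"
    by metis
  let ?H = "\<Inter>j. B j"
  have H: "?H \<in> sets M" "S \<subseteq> ?H" using B by auto
  have "measure M ?H \<le> hull_measure M S + 1 / real (Suc j)" for j
  proof -
    have "measure M ?H \<le> measure M (B j)"
      by (intro finite_measure_mono B) auto
    then show ?thesis using B(3)[of j] by linarith
  qed
  then have "measure M ?H \<le> hull_measure M S"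
    by (rule le_if_le_add_inverse_Suc)
  with H that hull_measure_le show ?thesis by (meson antisym)
qed

text \<open>Continuity from below of the outer measure, with no measurability of the
  \<open>S n\<close>. This is the property of a capacity that drives the truncation argument
  below.\<close>

lemma (in finite_measure) hull_measure_less_UN:
  assumes "incseq S" "(\<Union>n. S n) \<subseteq> space M" "c < hull_measure M (\<Union>n. S n)"
  shows "\<exists>n::nat. c < hull_measure M (S n)"
proof -
  have "\<exists>H. H \<in> sets M \<and> S n \<subseteq> H \<and> measure M H = hull_measure M (S n)" for n
    using hull_measure_attained[of "S n"] assms(2) by (metis UN_subset_iff UNIV_I)
  then obtain H where H: "\<And>n. H n \<in> sets M" "\<And>n. S n \<subseteq> H n"
    "\<And>n. measure M (H n) = hull_measure M (S n)"
    by metis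
  \<comment> \<open>The hulls need not increase, but their tail intersections do, and these still
    contain \<open>S n\<close> since \<open>S n\<close> lies in every later
    \<open>H k\<close>.\<close>
  define B where "B n = (\<Inter>k\<in>{n..}. H k)" for n
  have B: "B n \<in> sets M" for n
    unfolding B_def using H by (intro sets.countable_INT') auto
  have "incseq B" unfolding B_def incseq_def by force
  have SB: "S n \<subseteq> B n" for n
    unfolding B_def using H(2) \<open>incseq S\<close> by (fastforce simp: incseq_def)
  have "(\<lambda>n. measure M (B n)) \<longlonglongrightarrow> measure M (\<Union>n. B n)"
    using B \<open>incseq B\<close> by (intro finite_Lim_measure_incseq) auto
  moreover have "hull_measure M (\<Union>n. S n) \<le> measure M (\<Union>n. B n)"
    using B SB by (intro hull_measure_le UN_mono sets.countable_UN) auto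
  then have "c < measure M (\<Union>n. B n)" using assms(3) by linarith
  ultimately have "\<forall>\<^sub>F n in sequentially. c < measure M (B n)"
    by (rule order_tendstoD(1))
  then obtain n where "c < measure M (B n)"
    by (auto simp: eventually_sequentially)
  also have "\<dots> \<le> measure M (H n)"
    by (intro finite_measure_mono H) (auto simp: B_def)
  finally show ?thesis using H(3) by auto
qed

lemma compact_coordinate_box:
  fixes b :: "nat \<Rightarrow> real"
  shows "compact {w :: nat \<Rightarrow> complex. \<forall>i. norm (w i) \<le> b i}"
proof -
  have "compactin (product_topology (\<lambda>i. euclidean) UNIV) (PiE UNIV (\<lambda>i. cball (0::complex) (b i)))"
    unfolding compactin_PiE by simp
  moreover have "PiE UNIV (\<lambda>i. cball (0::complex) (b i)) = {w. \<forall>i. norm (w i) \<le> b i}"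
    by (auto simp: PiE_iff)
  ultimately show ?thesis by (simp add: euclidean_product_topology)
qed

text \<open>Closures of projections may be too large at each stage, but not in the limit: points of
  \<open>C\<close> whose projections tend to \<open>x\<close> have parameters bounded in every
  coordinate, so a subsequence converges and its limit lies in \<open>C\<close>.\<close>

lemma Inter_closure_projection_boxes:
  fixes C :: "('a::metric_space \<times> (nat \<Rightarrow> complex)) set" and b :: "nat \<Rightarrow> real"
  assumes C: "closed C"
    and x: "\<And>k. x \<in> closure (fst ` {p \<in> C. \<forall>i<k. norm (snd p i) \<le> b i})"
  shows "x \<in> fst ` C"
proof -
  have "\<exists>p. p \<in> C \<and> (\<forall>i<k. norm (snd p i) \<le> b i) \<and> dist (fst p) x < 1 / real (Suc k)" for k
    using x[of k] unfolding closure_approachable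
    by (force dest: spec[of _ "1 / real (Suc k)"])
  then obtain p where p: "\<And>k. p k \<in> C" "\<And>k i. i < k \<Longrightarrow> norm (snd (p k) i) \<le> b i"
    "\<And>k. dist (fst (p k)) x < 1 / real (Suc k)"
    by metis
  \<comment> \<open>Coordinate \<open>i\<close> is bounded by \<open>b i\<close> only for
    \<open>k > i\<close>; the finitely many \<open>k \<le> i\<close> enter through the
    maximum.\<close>
  define m where "m i = Max (insert (b i) ((\<lambda>k. norm (snd (p k) i)) ` {..i}))" for i
  have "norm (snd (p k) i) \<le> m i" for k i
  proof (cases "i < k")
    case True
    then have "norm (snd (p k) i) \<le> b i" by (rule p)
    also have "\<dots> \<le> m i" unfolding m_def by (intro Max_ge) auto
    finally show ?thesis .
  next
    case False
    then show ?thesis unfolding m_def by (intro Max_ge) auto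
  qed
  then have "\<forall>k. snd (p k) \<in> {w. \<forall>i. norm (w i) \<le> m i}" by simp
  then obtain l r where r: "strict_mono (r :: nat \<Rightarrow> nat)" "((\<lambda>k. snd (p k)) \<circ> r) \<longlonglongrightarrow> l"
    using compact_coordinate_box[of m]
    by (auto elim!: seq_compactE simp: compact_eq_seq_compact_metric)
  have "(\<lambda>k. dist (fst (p k)) x) \<longlonglongrightarrow> 0"
  proof (rule tendsto_sandwich[OF _ _ tendsto_const LIMSEQ_inverse_real_of_nat])
    show "\<forall>\<^sub>F k in sequentially. dist (fst (p k)) x \<le> inverse (real (Suc k))"
      using p(3) by (auto intro!: always_eventually simp: less_imp_le inverse_eq_divide)
  qed simp
  then have "(\<lambda>k. fst (p k)) \<longlonglongrightarrow> x"
    by (subst tendsto_dist_iff)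
  then have "((\<lambda>k. fst (p k)) \<circ> r) \<longlonglongrightarrow> x"
    using r(1) by (rule LIMSEQ_subseq_LIMSEQ)
  then have "(\<lambda>k. (fst (p (r k)), snd (p (r k)))) \<longlonglongrightarrow> (x, l)"
    using r(2) by (intro tendsto_Pair) (simp_all add: o_def)
  then have "(x, l) \<in> C"
    using C p(1) by (elim closed_sequentially[rotated 2]) auto
  then show ?thesis by force
qed

text \<open>Choquet's argument: bound the parameter coordinates one after another, keeping the outer
  measure of the projection above \<open>c\<close>. The closures of the projections are measurable
  and decrease to a set inside \<open>A\<close>.\<close>

lemma souslin_inner_approximation:
  fixes M :: "'a::metric_space measure"
  assumes "finite_measure M" "sets M = sets borel" "souslin A" "c < hull_measure M A"
  obtains L where "L \<in> sets M" "L \<subseteq> A" "c \<le> measure M L"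
proof -
  interpret finite_measure M by fact
  have space: "space M = UNIV" using assms(2) sets_eq_imp_space_eq by fastforce
  obtain C :: "('a \<times> (nat \<Rightarrow> complex)) set" where C: "closed C" "A = fst ` C"
    using assms(3) unfolding souslin_def by blast
  \<comment> \<open>Dependent choice: the strict inequality is the invariant that permits the next
    truncation, and the clause for \<open>k = 0\<close> fixes the start.\<close>
  have "\<exists>D. \<forall>k. (c < hull_measure M (fst ` D k) \<and> (k = 0 \<longrightarrow> D k = C)) \<and>
      (\<exists>j. D (Suc k) = {p \<in> D k. norm (snd p k) \<le> real j})"
  proof (rule dependent_nat_choice)
    show "\<exists>D. c < hull_measure M (fst ` D) \<and> ((0::nat) = 0 \<longrightarrow> D = C)"
      using assms(4) C(2) by blast
    fix D and k :: nat
    assume D: "c < hull_measure M (fst ` D) \<and> (k = 0 \<longrightarrow> D = C)"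
    let ?E = "\<lambda>j. {p \<in> D. norm (snd p k) \<le> real j}"
    have "incseq (\<lambda>j. fst ` ?E j)"
      unfolding incseq_def by (force intro: order_trans)
    moreover have "D = (\<Union>j. ?E j)" by (auto simp: real_arch_simple)
    then have "fst ` D = (\<Union>j. fst ` ?E j)" by (metis image_UN)
    ultimately have "\<exists>j. c < hull_measure M (fst ` ?E j)"
      using D by (intro hull_measure_less_UN) (simp_all add: space)
    then show "\<exists>D'. (c < hull_measure M (fst ` D') \<and> (Suc k = 0 \<longrightarrow> D' = C)) \<and>
        (\<exists>j. D' = {p \<in> D. norm (snd p k) \<le> real j})"
      by (metis (no_types, lifting) nat.distinct(1))
  qed
  then obtain D where D: "\<And>k. c < hull_measure M (fst ` D k)" "D 0 = C"
    and "\<forall>k. \<exists>j. D (Suc k) = {p \<in> D k. norm (snd p k) \<le> real j}"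
    by blast
  then obtain j where j: "\<And>k. D (Suc k) = {p \<in> D k. norm (snd p k) \<le> real (j k)}"
    by (metis (no_types) choice)
  have D_eq: "D k = {p \<in> C. \<forall>i<k. norm (snd p i) \<le> real (j i)}" for k
    by (induction k) (auto simp: D(2) j less_Suc_eq)
  let ?F = "\<lambda>k. closure (fst ` D k)"
  let ?L = "\<Inter>k. ?F k"
  show ?thesis
  proof (rule that[of ?L])
    show "?L \<in> sets M" by (auto simp: assms(2))
    show "?L \<subseteq> A"
      using Inter_closure_projection_boxes[OF C(1), of _ "\<lambda>i. real (j i)"] C(2)
      unfolding D_eq by blast
    have "decseq ?F"
      unfolding decseq_Suc_iff by (auto simp: j intro!: closure_mono)
    then have "(\<lambda>k. measure M (?F k)) \<longlonglongrightarrow> measure M ?L"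
      by (intro finite_Lim_measure_decseq) (auto simp: assms(2))
    moreover have "c \<le> measure M (?F k)" for k
      using D(1)[of k] hull_measure_le[of "?F k" "fst ` D k"]
      by (simp add: assms(2) closure_subset)
    ultimately show "c \<le> measure M ?L"
      by (intro LIMSEQ_le_const) auto
  qed
qed

text \<open>The measurable hull from outside and a countable union of inner approximations have the
  same measure, so they enclose \<open>A\<close> up to a null set.\<close>

lemma souslin_completion:
  fixes M :: "'a::metric_space measure"
  assumes "finite_measure M" "sets M = sets borel" "souslin A"
  shows "A \<in> sets (completion M)"
proof -
  interpret finite_measure M by fact
  have space: "space M = UNIV" using assms(2) sets_eq_imp_space_eq by fastforce
  obtain H where H: "H \<in> sets M" "A \<subseteq> H" "measure M H = hull_measure M A"
    using hull_measure_attained[of A] space by blast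
  have "\<exists>L. L \<in> sets M \<and> L \<subseteq> A \<and> measure M H - 1 / real (Suc k) \<le> measure M L" for k
  proof -
    have "measure M H - 1 / real (Suc k) < hull_measure M A" by (simp add: H)
    then show ?thesis using souslin_inner_approximation[OF assms] by metis
  qed
  then obtain L where L: "\<And>k. L k \<in> sets M" "\<And>k. L k \<subseteq> A"
    "\<And>k. measure M H - 1 / real (Suc k) \<le> measure M (L k)"
    by metis
  let ?L = "\<Union>k. L k"
  have Ls: "?L \<in> sets M" "?L \<subseteq> A" using L by auto
  have "measure M H \<le> measure M ?L + 1 / real (Suc k)" for k
    using finite_measure_mono[of "L k" ?L] Ls L(3)[of k] by force
  then have "measure M H \<le> measure M ?L"
    by (rule le_if_le_add_inverse_Suc)
  then have "measure M (H - ?L) = 0"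
    using finite_measure_Diff[of H ?L] finite_measure_mono[of ?L H] H Ls by fastforce
  then have "emeasure M (H - ?L) = 0"
    by (simp add: emeasure_eq_measure)
  then have "A \<in> completed_sets M"
    unfolding completed_sets_def using H Ls by blast
  then show ?thesis by (simp add: completed_sets_eq_sets_completion)
qed

section \<open>The tail part\<close>

text \<open>Finite prefixes are replaced by whole sequences \<open>w\<close> of which only the first
  \<open>n\<close> entries count, so that prefixes of every length range over the single space
  \<complex>^\<nat> along which analytic sets are projected.\<close>

lemma tail_part_eq:
  "tail_part \<sigma> x = (\<Inter>n. \<Inter>w. \<sigma> (\<lambda>i. if i < n then w i else x i))"
proof -
  have "replace_prefix y x = (\<lambda>i. if i < length y then y ! i else x i)" for y
    by (simp add: replace_prefix_def)
  then have "(\<Inter>n. \<Inter>w. \<sigma> (\<lambda>i. if i < n then w i else x i)) \<subseteq> tail_part \<sigma> x"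
    unfolding tail_part_def by fastforce
  moreover have "(\<lambda>i. if i < n then w i else x i) = replace_prefix (map w [0..<n]) x" for n w
    by (auto simp: replace_prefix_def)
  moreover have "tail_part \<sigma> x \<subseteq> \<sigma> (replace_prefix y x)" for y
    \<comment> \<open>A prefix of length \<open>l\<close> occurs in \<open>tail_part\<close> at
      index \<open>l + 1\<close>.\<close>
    unfolding tail_part_def by (auto dest!: bspec[of _ _ "Suc (length y)"])
  ultimately show ?thesis by (intro equalityI INT_greatest) simp_all
qed

text \<open>The complements of the \<open>S i\<close> are open and cover \<open>K\<close>; refine
  them to basic sets and use compactness. With a countable basis, an arbitrary intersection is
  thereby handled through countably many finite families.\<close>

lemma Inter_closed_compact_empty_iff:
  fixes S :: "'i \<Rightarrow> 'a::topological_space set"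
  assumes "topological_basis \<B>" "\<And>i. closed (S i)" "compact K"
  shows "(\<Inter>i. S i) \<inter> K = {} \<longleftrightarrow>
    (\<exists>\<F>. finite \<F> \<and> \<F> \<subseteq> \<B> \<and> K \<subseteq> \<Union>\<F> \<and> (\<forall>B\<in>\<F>. \<exists>i. S i \<inter> B = {}))"
proof
  assume empty: "(\<Inter>i. S i) \<inter> K = {}"
  let ?G = "{B \<in> \<B>. \<exists>i. S i \<inter> B = {}}"
  have cover: "K \<subseteq> \<Union>?G"
  proof
    fix z assume "z \<in> K"
    then obtain i where "z \<in> - S i" using empty by blast
    moreover have "open (- S i)" using assms(2) by auto
    ultimately obtain B where "B \<in> \<B>" "z \<in> B" "B \<subseteq> - S i"
      using assms(1) by (metis topological_basisE)
    then show "z \<in> \<Union>?G" by blast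
  qed
  have "open B" if "B \<in> ?G" for B
    using assms(1) that by (auto intro: topological_basis_open)
  then obtain \<F> where "\<F> \<subseteq> ?G" "finite \<F>" "K \<subseteq> \<Union>\<F>"
    using compactE[OF assms(3) cover] by blast
  then show "\<exists>\<F>. finite \<F> \<and> \<F> \<subseteq> \<B> \<and> K \<subseteq> \<Union>\<F> \<and> (\<forall>B\<in>\<F>. \<exists>i. S i \<inter> B = {})"
    by blast
qed blast

theorem mainTheorem4:
  fixes \<sigma> :: "(nat \<Rightarrow> complex) \<Rightarrow> complex set"
  assumes "closed_valued complex_sequences \<sigma>"
    and "open_measurable complex_sequences \<sigma>"
  shows "universally_open_measurable complex_sequences (tail_part \<sigma>)"
proof -
  define splice :: "nat \<Rightarrow> (nat \<Rightarrow> complex) \<Rightarrow> (nat \<Rightarrow> complex) \<Rightarrow> nat \<Rightarrow> complex"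
    where "splice n w x = (\<lambda>i. if i < n then w i else x i)" for n w x
  have closed: "closed (\<sigma> x)" for x
    using assms(1) by (simp add: closed_valued_def space_PiM)
  \<comment> \<open>In this countable product the product \<sigma>-algebra is the Borel
    \<sigma>-algebra of the product topology.\<close>
  have meas: "{x. \<sigma> x \<inter> U = {}} \<in> sets borel" if "open U" for U
  proof -
    have "{x. \<sigma> x \<inter> U \<noteq> {}} \<in> sets borel"
      using assms(2) that
      by (simp add: open_measurable_def multi_preimage_def space_PiM sets_PiM_equal_borel)
    then have "- {x. \<sigma> x \<inter> U \<noteq> {}} \<in> sets borel" by (simp only: borel_comp)
    then show ?thesis by (simp add: Collect_neg_eq[symmetric])
  qed
  have souslin: "souslin {x. \<exists>w. \<sigma> (splice n w x) \<inter> U = {}}" if "open U" for n U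
  proof -
    \<comment> \<open>Splicing is continuous in the pair \<open>(x, w)\<close>, so the existential
      over \<open>w\<close> projects a Borel set.\<close>
    let ?g = "\<lambda>p. splice n (snd p) (fst p)"
    have "continuous_on UNIV (\<lambda>p. ?g p i)" for i
      unfolding splice_def
      by (cases "i < n") (simp_all add: continuous_on_coordinate_snd
          continuous_on_product_then_coordinatewise continuous_on_fst continuous_on_id)
    then have "?g \<in> borel_measurable borel"
      by (intro borel_measurable_continuous_onI continuous_on_coordinatewise_then_product)
    then have "?g -` {x. \<sigma> x \<inter> U = {}} \<inter> space borel \<in> sets borel"
      using meas[OF that] by (rule measurable_sets)
    then have "souslin (fst ` (?g -` {x. \<sigma> x \<inter> U = {}}))"
      by (intro souslin_fst_image borel_souslin) simp
    moreover have "fst ` (?g -` {x. \<sigma> x \<inter> U = {}}) = {x. \<exists>w. \<sigma> (splice n w x) \<inter> U = {}}"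
      by (force simp: image_iff)
    ultimately show ?thesis by simp
  qed
  obtain \<B> :: "complex set set" where \<B>: "countable \<B>" "topological_basis \<B>"
    using ex_countable_basis by blast
  have "{x. tail_part \<sigma> x \<inter> U \<noteq> {}} \<in> completed_sets \<nu>"
    if U: "open U" and \<nu>: "finite_measure \<nu>" "sets \<nu> = sets complex_sequences" for U \<nu>
  proof -
    have sets: "sets \<nu> = sets borel" using \<nu>(2) by (simp add: sets_PiM_equal_borel)
    have space: "space \<nu> = UNIV"
      using sets sets_eq_imp_space_eq by fastforce
    have avoid: "{x. \<exists>n w. \<sigma> (splice n w x) \<inter> B = {}} \<in> sets (completion \<nu>)" if "open B" for B
    proof -
      \<comment> \<open>The uncountable choice of \<open>w\<close> is absorbed by the projection;
        only a countable union over \<open>n\<close> remains.\<close>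
      have "(\<Union>n. {x. \<exists>w. \<sigma> (splice n w x) \<inter> B = {}}) \<in> sets (completion \<nu>)"
        by (intro sets.countable_UN image_subsetI souslin_completion \<nu>(1) sets souslin that)
      moreover have "(\<Union>n. {x. \<exists>w. \<sigma> (splice n w x) \<inter> B = {}}) = {x. \<exists>n w. \<sigma> (splice n w x) \<inter> B = {}}"
        by blast
      ultimately show ?thesis by simp
    qed
    have compact: "{x. tail_part \<sigma> x \<inter> K = {}} \<in> sets (completion \<nu>)" if "compact K" for K
    proof -
      \<comment> \<open>Only countably many covers arise, as a countable basis has countably many
        finite subfamilies.\<close>
      let ?\<C> = "{\<F>. (finite \<F> \<and> \<F> \<subseteq> \<B>) \<and> K \<subseteq> \<Union>\<F>}"
      have "countable ?\<C>"
        by (rule countable_subset[OF _ countable_Collect_finite_subset[OF \<B>(1)]]) auto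
      have "tail_part \<sigma> x \<inter> K = {} \<longleftrightarrow>
          (\<exists>\<F>\<in>?\<C>. \<forall>B\<in>\<F>. \<exists>n w. \<sigma> (splice n w x) \<inter> B = {})" for x
      proof -
        have "tail_part \<sigma> x = (\<Inter>(n, w). \<sigma> (splice n w x))"
          by (auto simp: tail_part_eq splice_def)
        then show ?thesis
          using Inter_closed_compact_empty_iff[OF \<B>(2) _ that,
              of "\<lambda>(n, w). \<sigma> (splice n w x)"] closed
          by (auto simp: split_beta)
      qed
      then have "{x. tail_part \<sigma> x \<inter> K = {}} =
          (\<Union>\<F>\<in>?\<C>. {x \<in> space (completion \<nu>). \<forall>B\<in>\<F>. x \<in> {x. \<exists>n w. \<sigma> (splice n w x) \<inter> B = {}}})"
        unfolding space_completion space by (intro set_eqI) (simp only: mem_Collect_eq UN_iff UNIV_I simp_thms)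
      also have "\<dots> \<in> sets (completion \<nu>)"
      proof (rule sets.countable_UN'[OF \<open>countable ?\<C>\<close>], rule image_subsetI)
        fix \<F> assume \<F>: "\<F> \<in> ?\<C>"
        then have "{x. \<exists>n w. \<sigma> (splice n w x) \<inter> B = {}} \<in> sets (completion \<nu>)" if "B \<in> \<F>" for B
          using that \<B>(2) by (intro avoid) (auto intro: topological_basis_open)
        then show "{x \<in> space (completion \<nu>). \<forall>B\<in>\<F>. x \<in> {x. \<exists>n w. \<sigma> (splice n w x) \<inter> B = {}}}
            \<in> sets (completion \<nu>)"
          using \<F> by (intro sets.sets_Collect_finite_All) (auto simp: space)
      qed
      finally show ?thesis .
    qed
    \<comment> \<open>Compactness was needed for the covers; an open set is a countable union of
      compact sets, so meeting \<open>U\<close> means meeting some \<open>K n\<close>.\<close>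
    obtain K :: "nat \<Rightarrow> complex set" where K: "\<And>n. compact (K n)" "\<Union>(range K) = U"
      by (rule open_Union_compact_subsets[OF U]) blast
    have "{x. tail_part \<sigma> x \<inter> U \<noteq> {}} =
        (\<Union>n. space (completion \<nu>) - {x. tail_part \<sigma> x \<inter> K n = {}})"
      unfolding K(2)[symmetric] space_completion space by auto
    also have "\<dots> \<in> sets (completion \<nu>)"
      by (intro sets.countable_UN image_subsetI sets.compl_sets compact K(1))
    finally show ?thesis by (simp add: completed_sets_eq_sets_completion)
  qed
  then show ?thesis
    by (simp add: universally_open_measurable_def universally_measurable_sets_def
        multi_preimage_def space_PiM)
qed

end
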